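(* Every finite field (i.e. finite division ring, multiplication not assumed commutative) is commutative.
   Context: In this paper a "field" (corps) is a non-zero ring, not necessarily commutative, in which every non-zero element has a two-sided multiplicative inverse. *)

theory Defs
  imports "HOL-Algebra.Ring"
begin

(* Not necessarily commutative; HOL-Algebra's own "field" locale includes
   commutativity of the multiplication. *)
locale skew_field = ring +
  assumes one_not_zero: "\<one> \<noteq> \<zero>"
    and two_sided_inverse:
      "\<lbrakk>x \<in> carrier R; x \<noteq> \<zero>\<rbrakk> \<Longrightarrow> \<exists>y \<in> carrier R. x \<otimes> y = \<one> \<and> y \<otimes> x = \<one>"

end

theory Submission
  imports Defs "HOL-Algebra.Subrings" "HOL-Algebra.Group_Action"
    "HOL-Library.Disjoint_Sets" "HOL-Computational_Algebra.Fundamental_Theorem_Algebra"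
begin

text \<open>
  This is Wedderburn's little theorem, proved by Witt's argument: the class equation of the
  multiplicative group is incompatible with the size of a cyclotomic value.

  Let \<open>Z\<close> be the center, with \<open>q\<close> elements. Every subring that contains \<open>Z\<close> is a vector space over
  \<open>Z\<close>, so \<open>R\<close> has \<open>q ^ n\<close> elements and the centralizer of \<open>x\<close> has \<open>q ^ d\<close> elements for some \<open>d\<close>; as
  \<open>R\<close> is also a left vector space over this centralizer, \<open>d\<close> divides \<open>n\<close>
  (\<open>card_eq_power_of_subring\<close> serves all three purposes). By orbit-stabilizer, a noncentral \<open>x\<close> has
  \<open>(q ^ n - 1) / (q ^ d - 1)\<close> conjugates, and \<open>d < n\<close>.

  The value \<open>a\<close> of the \<open>n\<close>-th cyclotomic polynomial at \<open>q\<close> is an integer dividing each of these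
  quotients (\<open>cyclotomic_divisor\<close>). Hence \<open>a\<close> divides \<open>q ^ n - q\<close>, the number of noncentral elements
  (\<open>dvd_card_noncentral\<close>); since it also divides \<open>q ^ n - 1\<close>, it divides \<open>q - 1\<close>. But for
  \<open>n \<ge> 2\<close> the value \<open>a\<close> is a product of factors \<open>q - z\<close> with \<open>z \<noteq> 1\<close> on the unit circle, each of
  absolute value greater than \<open>q - 1 \<ge> 1\<close>, so \<open>\<bar>a\<bar> > q - 1\<close> (\<open>norm_cyclotomic_gt\<close>), a contradiction.
  Therefore \<open>n = 1\<close> and \<open>R\<close> equals its center.
\<close>

section \<open>Integrality of monic polynomials with prescribed roots\<close>

definition root_poly :: "'a::comm_ring_1 set \<Rightarrow> 'a poly"
  where "root_poly S = (\<Prod>z\<in>S. [:-z, 1:])"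

text \<open>
  Integrality is a property of polynomials over the field that contains the roots; this avoids
  transferring factorizations between \<open>int poly\<close> and \<open>complex poly\<close>.
\<close>
definition int_coeffs :: "'a::ring_1 poly \<Rightarrow> bool"
  where "int_coeffs p \<longleftrightarrow> (\<forall>i. Polynomial.coeff p i \<in> \<int>)"

lemma int_coeffs_mult:
  assumes "int_coeffs p" "int_coeffs q"
  shows "int_coeffs (p * q)"
  using assms unfolding int_coeffs_def coeff_mult by (auto intro!: Ints_sum Ints_mult)

lemma int_coeffs_diff:
  assumes "int_coeffs p" "int_coeffs q"
  shows "int_coeffs (p - q)"
  using assms unfolding int_coeffs_def by (auto intro!: Ints_diff)

text \<open>
  Long division by a monic polynomial never leaves the ring of coefficients: the leading coefficient
  of \<open>h\<close> is that of \<open>h * g\<close>, hence an integer, and subtracting the leading term of \<open>h\<close> lowers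
  the degree.
\<close>
lemma int_coeffs_divide_monic:
  fixes h g :: "'a::idom poly"
  assumes "int_coeffs g" "lead_coeff g = 1" "int_coeffs (h * g)"
  shows "int_coeffs h"
  using assms(3)
proof (induction "degree h" arbitrary: h rule: less_induct)
  case less
  define m where "m = Polynomial.monom (lead_coeff h) (degree h)"
  have g0: "g \<noteq> 0" using assms(2) by auto
  have "lead_coeff (h * g) = lead_coeff h"
    using assms(2) by (simp add: lead_coeff_mult)
  hence lc: "lead_coeff h \<in> \<int>"
    using less.prems unfolding int_coeffs_def by metis
  hence m: "int_coeffs m"
    by (auto simp: int_coeffs_def m_def)
  show ?case
  proof (cases "degree h = 0")
    case True
    hence "h = m" unfolding m_def
      by (metis degree_0_id monom_0)
    with m show ?thesis by simp
  next
    case False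
    have "degree (h - m) < degree h"
      unfolding m_def using False
      by (intro degree_lessI) (auto simp: not_less le_degree coeff_eq_0 le_less)
    moreover have "int_coeffs ((h - m) * g)"
      using int_coeffs_diff[OF less.prems int_coeffs_mult[OF m assms(1)]]
      by (simp add: algebra_simps)
    ultimately have hm: "int_coeffs (h - m)" by (rule less.hyps)
    have "Polynomial.coeff h i = Polynomial.coeff (h - m) i + Polynomial.coeff m i" for i by simp
    with hm m show ?thesis unfolding int_coeffs_def by (metis Ints_add)
  qed
qed

lemma int_coeffs_poly:
  assumes "int_coeffs p"
  shows "poly p (of_nat q) \<in> \<int>"
  using assms unfolding int_coeffs_def poly_altdef by (auto intro!: Ints_sum Ints_mult Ints_power)

lemma lead_coeff_root_poly: "lead_coeff (root_poly (S :: 'a::idom set)) = 1"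
  unfolding root_poly_def by (simp add: lead_coeff_prod)

lemma root_poly_Un:
  assumes "finite A" "finite B" "A \<inter> B = {}"
  shows "root_poly (A \<union> B) = root_poly A * root_poly B"
  unfolding root_poly_def using assms by (rule prod.union_disjoint)

lemma int_coeffs_root_poly_Diff:
  fixes B :: "'a::idom set"
  assumes "finite B" "A \<subseteq> B" "int_coeffs (root_poly A)" "int_coeffs (root_poly B)"
  shows "int_coeffs (root_poly (B - A))"
proof (rule int_coeffs_divide_monic[OF assms(3) lead_coeff_root_poly])
  have "root_poly (B - A) * root_poly A = root_poly (B - A \<union> A)"
    by (rule root_poly_Un[symmetric]) (use assms finite_subset in auto)
  also have "B - A \<union> A = B" using assms(2) by auto
  finally show "int_coeffs (root_poly (B - A) * root_poly A)" using assms(4) by simp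
qed

lemma int_coeffs_root_poly_UNION:
  fixes A :: "'i \<Rightarrow> 'a::idom set"
  assumes "finite I" "\<And>i. i \<in> I \<Longrightarrow> finite (A i)" "disjoint_family_on A I"
    and "\<And>i. i \<in> I \<Longrightarrow> int_coeffs (root_poly (A i))"
  shows "int_coeffs (root_poly (\<Union>i\<in>I. A i))"
  using assms
proof (induction I)
  case empty
  show ?case by (auto simp: root_poly_def int_coeffs_def coeff_1)
next
  case (insert i I)
  have "A i \<inter> (\<Union>j\<in>I. A j) = {}"
    using insert.prems(2) insert.hyps(2) by (auto simp: disjoint_family_on_def)
  moreover have "disjoint_family_on A I"
    using insert.prems(2) by (auto simp: disjoint_family_on_def)
  ultimately show ?case
    using insert by (auto simp: root_poly_Un intro!: int_coeffs_mult)
qed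

section \<open>Values of cyclotomic polynomials\<close>

text \<open>
  For \<open>n > 0\<close>, \<open>root_poly (primitive_roots n)\<close> is the \<open>n\<close>-th cyclotomic polynomial. For \<open>n = 0\<close> the
  set is the whole plane.
\<close>
definition primitive_roots :: "nat \<Rightarrow> complex set"
  where "primitive_roots n = {z. z ^ n = 1 \<and> (\<forall>d. 0 < d \<longrightarrow> d < n \<longrightarrow> z ^ d \<noteq> 1)}"

lemma root_poly_roots_unity:
  assumes "0 < n"
  shows "root_poly {z::complex. z ^ n = 1} = Polynomial.monom 1 n - 1"
proof -
  let ?p = "Polynomial.monom 1 n - 1 :: complex poly"
  have lc: "lead_coeff ?p = 1"
  proof -
    have "degree ?p = n"
      using assms degree_add_eq_left[of "-1" "Polynomial.monom (1::complex) n"]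
      by (simp add: degree_monom_eq)
    thus ?thesis using assms by (simp add: coeff_1)
  qed
  have "rsquarefree ?p"
    unfolding rsquarefree_roots using assms
    by (auto simp: poly_monom pderiv_diff pderiv_monom power_0_left)
  from complex_poly_decompose_rsquarefree[OF this] show ?thesis
    by (simp only: lc) (simp add: root_poly_def poly_monom)
qed

lemma int_coeffs_root_poly_roots_unity:
  assumes "0 < n"
  shows "int_coeffs (root_poly {z::complex. z ^ n = 1})"
  unfolding root_poly_roots_unity[OF assms] int_coeffs_def by (auto simp: coeff_1)

lemma primitive_roots_subset: "primitive_roots n \<subseteq> {z. z ^ n = 1}"
  by (auto simp: primitive_roots_def)

lemma finite_primitive_roots: "0 < n \<Longrightarrow> finite (primitive_roots n)"
  using finite_subset[OF primitive_roots_subset finite_roots_unity[of n]] by auto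

text \<open>
  The index \<open>d\<close> of the part containing \<open>z\<close> is the multiplicative order of \<open>z\<close>; the factorization of
  \<open>X ^ n - 1\<close> into cyclotomic polynomials is this equation together with disjointness.
\<close>
lemma roots_unity_eq_UN_primitive_roots:
  assumes "0 < n"
  shows "{z. z ^ n = 1} = (\<Union>d\<in>{d. d dvd n}. primitive_roots d)"
proof (intro equalityI subsetI)
  fix z :: complex assume "z \<in> {z. z ^ n = 1}"
  hence z: "z ^ n = 1" by simp
  define d where "d = (LEAST d. 0 < d \<and> z ^ d = 1)"
  have d: "0 < d \<and> z ^ d = 1"
    unfolding d_def by (rule LeastI[of _ n]) (use z assms in auto)
  have min: "z ^ e \<noteq> 1" if "0 < e" "e < d" for e
    using not_less_Least[of e "\<lambda>d. 0 < d \<and> z ^ d = 1"] that unfolding d_def by auto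
  have "z ^ n = (z ^ d) ^ (n div d) * z ^ (n mod d)"
    by (metis mult_div_mod_eq power_add power_mult)
  hence "z ^ (n mod d) = 1" using z d by simp
  hence "n mod d = 0" using min[of "n mod d"] d by auto
  moreover have "z \<in> primitive_roots d"
    using d min by (auto simp: primitive_roots_def)
  ultimately show "z \<in> (\<Union>d\<in>{d. d dvd n}. primitive_roots d)" by auto
next
  fix z assume "z \<in> (\<Union>d\<in>{d. d dvd n}. primitive_roots d)"
  thus "z \<in> {z. z ^ n = 1}" by (auto simp: primitive_roots_def power_mult elim!: dvdE)
qed

lemma disjoint_primitive_roots: 
  assumes "0 \<notin> I"
  shows "disjoint_family_on primitive_roots I"
proof -
  have "z ^ d = 1 \<and> (\<forall>e. 0 < e \<longrightarrow> e < d \<longrightarrow> z ^ e \<noteq> 1)" if "z \<in> primitive_roots d" for z d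
    using that by (auto simp: primitive_roots_def)
  hence "d = e" if "z \<in> primitive_roots d" "z \<in> primitive_roots e" "0 < d" "0 < e" for z d e
    using that by (metis linorder_neqE_nat)
  thus ?thesis using assms unfolding disjoint_family_on_def
    by (metis disjoint_iff gr0I)
qed

text \<open>
  Removing from the \<open>n\<close>-th roots of unity the primitive roots of smaller orders amounts to dividing
  \<open>X ^ n - 1\<close> by a monic polynomial that is integral by induction.
\<close>
lemma int_coeffs_cyclotomic:
  assumes "0 < n"
  shows "int_coeffs (root_poly (primitive_roots n))"
  using assms
proof (induction n rule: less_induct)
  case (less n)
  let ?D = "{d. d dvd n \<and> d \<noteq> n}"
  have D: "0 < d \<and> d < n" if "d \<in> ?D" for d
    using that less.prems dvd_pos_nat[of n d] dvd_imp_le[of d n] by simp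
  have D0: "0 \<notin> insert n ?D" using less.prems D by auto
  have "{d. d dvd n} = insert n ?D" by auto
  hence U: "{z. z ^ n = 1} = primitive_roots n \<union> (\<Union>d\<in>?D. primitive_roots d)"
    using roots_unity_eq_UN_primitive_roots[OF less.prems] by simp
  have "primitive_roots n \<inter> (\<Union>d\<in>?D. primitive_roots d) = {}"
    using disjoint_primitive_roots[OF D0] by (auto simp: disjoint_family_on_def)
  with U have eq: "primitive_roots n = {z. z ^ n = 1} - (\<Union>d\<in>?D. primitive_roots d)"
    and sub: "(\<Union>d\<in>?D. primitive_roots d) \<subseteq> {z. z ^ n = 1}" by auto
  have fin: "finite ?D" using less.prems by simp
  have "int_coeffs (root_poly (\<Union>d\<in>?D. primitive_roots d))"
  proof (rule int_coeffs_root_poly_UNION[OF fin])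
    show "disjoint_family_on primitive_roots ?D"
      by (rule disjoint_primitive_roots) (use D0 in auto)
  qed (use D finite_primitive_roots less.IH in auto)
  from int_coeffs_root_poly_Diff[OF _ sub this int_coeffs_root_poly_roots_unity[OF less.prems]]
  show ?case using finite_roots_unity[of n] less.prems unfolding eq by auto
qed

text \<open>
  On the unit circle \<open>1\<close> is the only point at distance \<open>q - 1\<close> from \<open>q\<close>, all others are farther.
  Since all factors exceed \<open>q - 1 \<ge> 1\<close>, a single one already yields the bound; so the existence of a
  primitive root has to be established.
\<close>
lemma norm_cyclotomic_gt:
  assumes "2 \<le> n" "2 \<le> q"
  shows "norm (poly (root_poly (primitive_roots n)) (of_nat q)) > real q - 1"
proof -
  let ?P = "primitive_roots n"
  have fin: "finite ?P" using finite_primitive_roots assms by simp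
  have factor: "norm (of_nat q - z) > real q - 1" if "z \<in> ?P" for z
  proof -
    have z: "z ^ n = 1" "z \<noteq> 1"
      using that assms(1) by (auto simp: primitive_roots_def dest: spec[of _ 1])
    have nz: "norm z = 1" using z(1) assms(1)
      by (metis norm_one norm_power power_eq_1_iff norm_ge_zero not_numeral_le_zero)
    have "Re z < 1"
    proof (rule ccontr)
      assume "\<not> Re z < 1"
      hence "Re z = 1" using complex_Re_le_cmod[of z] nz by simp
      moreover from this have "Im z = 0" using nz by (simp add: cmod_def)
      ultimately show False using z(2) by (simp add: complex_eq_iff)
    qed
    hence "real q - 1 < Re (of_nat q - z)" by simp
    also have "\<dots> \<le> norm (of_nat q - z)" by (rule complex_Re_le_cmod)
    finally show ?thesis .
  qed
  define w where "w = cis (2 * pi / real n)"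
  have "w ^ n = 1" using assms by (simp add: w_def DeMoivre)
  moreover have "w ^ d \<noteq> 1" if "0 < d" "d < n" for d
  proof
    assume "w ^ d = 1"
    hence "cis (2 * pi * real d / real n) = cis (2 * pi * real 0 / real n)"
      by (simp add: w_def DeMoivre mult_ac)
    with bij_betw_roots_unity[of n] that assms show False
      unfolding bij_betw_def inj_on_def by (metis lessThan_iff less_numeral_extra(3) gr_implies_not0 neq0_conv)
  qed
  ultimately have w: "w \<in> ?P" by (auto simp: primitive_roots_def)
  have "real q - 1 < norm (of_nat q - w)" using factor[OF w] .
  also have "\<dots> \<le> norm (of_nat q - w) * (\<Prod>z\<in>?P - {w}. norm (of_nat q - z))"
  proof -
    have "1 \<le> (\<Prod>z\<in>?P - {w}. norm (of_nat q - z))"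
      by (rule prod_ge_1) (use factor assms(2) in force)
    thus ?thesis by (simp add: mult_le_cancel_left1)
  qed
  also have "\<dots> = (\<Prod>z\<in>?P. norm (of_nat q - z))"
    using fin w by (simp add: prod.remove)
  also have "\<dots> = norm (poly (root_poly ?P) (of_nat q))"
    by (simp add: root_poly_def poly_prod prod_norm)
  finally show ?thesis .
qed

text \<open>
  For a proper divisor \<open>d\<close> of \<open>n\<close>, no primitive \<open>n\<close>-th root of unity is a \<open>d\<close>-th root of unity, so
  \<open>X ^ n - 1\<close> is the product of \<open>X ^ d - 1\<close>, the \<open>n\<close>-th cyclotomic polynomial, and a third factor. The
  third factor is integral as well, hence the divisibility holds among the integer values at \<open>q\<close>
  and not just for complex polynomials.
\<close>
lemma cyclotomic_divisor:
  fixes n q :: nat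
  assumes "2 \<le> n" "2 \<le> q"
  obtains a :: int where "\<bar>a\<bar> > int q - 1"
    and "\<And>d m. \<lbrakk>0 < d; d dvd n; d < n; m * (int q ^ d - 1) = int q ^ n - 1\<rbrakk> \<Longrightarrow> a dvd m"
proof -
  let ?U = "\<lambda>d. {z::complex. z ^ d = 1}" and ?P = "primitive_roots n"
  have n: "0 < n" using assms by simp
  obtain a where a: "poly (root_poly ?P) (of_nat q) = of_int a"
    using int_coeffs_poly[OF int_coeffs_cyclotomic[OF n]] by (auto elim: Ints_cases)
  have U: "poly (root_poly (?U d)) (of_nat q) = of_int (int q ^ d - 1)" if "0 < d" for d
    using that by (simp add: root_poly_roots_unity poly_monom)
  have "\<bar>a\<bar> > int q - 1"
    using norm_cyclotomic_gt[OF assms] unfolding a by simp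
  moreover have "a dvd m"
    if d: "0 < d" "d dvd n" "d < n" and m: "m * (int q ^ d - 1) = int q ^ n - 1" for d m
  proof -
    let ?B = "?U n - ?U d"
    have sub: "?U d \<subseteq> ?U n" using d by (auto simp: power_mult elim!: dvdE)
    have PB: "?P \<subseteq> ?B" using d by (auto simp: primitive_roots_def)
    have finU: "finite (?U n)" using finite_roots_unity[of n] n by simp
    hence finB: "finite ?B" by simp
    have B: "int_coeffs (root_poly ?B)"
      by (rule int_coeffs_root_poly_Diff[OF finU sub])
        (use int_coeffs_root_poly_roots_unity d n in auto)
    obtain b where b: "poly (root_poly (?B - ?P)) (of_nat q) = of_int b"
      using int_coeffs_poly[OF int_coeffs_root_poly_Diff[OF finB PB int_coeffs_cyclotomic[OF n] B]]
      by (auto elim: Ints_cases)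
    have "?U n = ?U d \<union> (?P \<union> (?B - ?P))" using sub PB by auto
    also have "root_poly \<dots> = root_poly (?U d) * root_poly (?P \<union> (?B - ?P))"
      by (rule root_poly_Un) (use finite_subset[OF sub finU] finite_subset[OF PB finB] finB PB in auto)
    also have "root_poly (?P \<union> (?B - ?P)) = root_poly ?P * root_poly (?B - ?P)"
      by (rule root_poly_Un) (use finB finite_subset[OF PB finB] in auto)
    finally have "of_int (int q ^ n - 1) = (of_int ((int q ^ d - 1) * (a * b)) :: complex)"
      using U[OF n] U[OF d(1)] a b by (simp only: poly_mult of_int_mult)
    hence "(int q ^ d - 1) * m = (int q ^ d - 1) * (a * b)"
      using m by (simp only: of_int_eq_iff mult.commute)
    moreover have "int q ^ d - 1 \<noteq> 0"
      using one_less_power[of "int q" d] assms(2) d(1) by linarith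
    ultimately have "m = a * b" by simp
    thus ?thesis by simp
  qed
  ultimately show thesis by (rule that)
qed

section \<open>Centralizers and their cardinalities\<close>

text \<open>The center is the special case \<open>S = carrier R\<close>.\<close>
definition centralizer :: "('a, 'b) ring_scheme \<Rightarrow> 'a set \<Rightarrow> 'a set"
  where "centralizer R S = {y \<in> carrier R. \<forall>s\<in>S. s \<otimes>\<^bsub>R\<^esub> y = y \<otimes>\<^bsub>R\<^esub> s}"

context skew_field
begin

lemma Units_eq_nonzero: "Units R = carrier R - {\<zero>}"
proof (intro equalityI subsetI)
  fix x assume x: "x \<in> Units R"
  hence "x \<noteq> \<zero>" using one_not_zero by (metis Units_closed Units_inv_closed Units_l_inv r_null)
  with x show "x \<in> carrier R - {\<zero>}" by auto
next
  fix x assume "x \<in> carrier R - {\<zero>}"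
  thus "x \<in> Units R" using two_sided_inverse[of x] by (auto simp: Units_def)
qed

lemma subring_centralizer:
  assumes "S \<subseteq> carrier R"
  shows "subring (centralizer R S) R"
proof (rule subringI)
  fix h1 h2 assume h: "h1 \<in> centralizer R S" "h2 \<in> centralizer R S"
  have "s \<otimes> (h1 \<otimes> h2) = h1 \<otimes> h2 \<otimes> s" if "s \<in> S" for s
  proof -
    have c: "s \<in> carrier R" "h1 \<in> carrier R" "h2 \<in> carrier R"
      and e: "s \<otimes> h1 = h1 \<otimes> s" "s \<otimes> h2 = h2 \<otimes> s"
      using h that assms by (auto simp: centralizer_def)
    have "s \<otimes> (h1 \<otimes> h2) = h1 \<otimes> s \<otimes> h2" using c by (simp add: m_assoc[symmetric] e)
    also have "\<dots> = h1 \<otimes> h2 \<otimes> s" using c by (simp add: m_assoc e)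
    finally show ?thesis .
  qed
  thus "h1 \<otimes> h2 \<in> centralizer R S" using h by (auto simp: centralizer_def)
qed (use assms in \<open>auto simp: centralizer_def subset_iff l_minus r_minus l_distr r_distr\<close>)

lemma centralizer_inv_closed:
  assumes "S \<subseteq> carrier R" "y \<in> centralizer R S" "y \<noteq> \<zero>"
  shows "inv y \<in> centralizer R S"
proof -
  have y: "y \<in> Units R" "y \<in> carrier R" using assms by (auto simp: centralizer_def Units_eq_nonzero)
  have "s \<otimes> inv y = inv y \<otimes> s" if "s \<in> S" for s
  proof -
    have s: "s \<in> carrier R" "s \<otimes> y = y \<otimes> s" using that assms by (auto simp: centralizer_def)
    have "s \<otimes> inv y = inv y \<otimes> (y \<otimes> s) \<otimes> inv y" using s y by (simp add: m_assoc[symmetric])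
    also have "\<dots> = inv y \<otimes> (s \<otimes> y) \<otimes> inv y" using s by simp
    also have "\<dots> = inv y \<otimes> s" using s(1) y by (simp add: m_assoc)
    finally show ?thesis .
  qed
  thus ?thesis using y by (auto simp: centralizer_def)
qed

text \<open>
  The reason is that \<open>V\<close> is a left vector space over the division ring \<open>K\<close>. Instead of a basis, the
  proof takes a maximal subspace \<open>W\<close> whose cardinality is a power of that of \<open>K\<close>. If some \<open>v\<close> were
  outside \<open>W\<close>, each element of the subspace \<open>W + K v\<close> would be \<open>w + k v\<close> for a unique pair
  \<open>(w, k)\<close>, and this larger subspace would contradict maximality.
\<close>
lemma card_eq_power_of_subring:
  assumes fin: "finite (carrier R)"
    and K: "subring K R" "\<And>k. k \<in> K \<Longrightarrow> k \<noteq> \<zero> \<Longrightarrow> inv k \<in> K"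
    and V: "subring V R" "K \<subseteq> V"
  obtains i where "card V = card K ^ i"
proof -
  note Kc = subringE[OF K(1)] and Vc = subringE[OF V(1)]
  let ?sub = "\<lambda>W. W \<subseteq> V \<and> \<zero> \<in> W \<and> (\<forall>u\<in>W. \<forall>w\<in>W. u \<oplus> w \<in> W) \<and> (\<forall>k\<in>K. \<forall>w\<in>W. k \<otimes> w \<in> W)"
  define F where "F = {W. ?sub W \<and> (\<exists>i. card W = card K ^ i)}"
  have finV: "finite V" using fin Vc(1) finite_subset by auto
  have "F \<subseteq> Pow V" by (auto simp: F_def)
  hence "finite F" using finV finite_subset by auto
  moreover have "{\<zero>} \<in> F"
    using Vc Kc by (auto simp: F_def subset_iff intro!: exI[of _ 0])
  ultimately obtain W where W: "W \<in> F" and max: "\<And>W'. W' \<in> F \<Longrightarrow> W \<subseteq> W' \<Longrightarrow> W' = W"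
    using finite_has_maximal2[of F "{\<zero>}"] by metis
  obtain i where i: "card W = card K ^ i" and subW: "?sub W" using W by (auto simp: F_def)
  have Wc: "w \<in> carrier R" if "w \<in> W" for w using that subW Vc(1) by auto
  have kc: "k \<in> carrier R" if "k \<in> K" for k using that Kc(1) by auto
  have Wneg: "\<ominus> w \<in> W" if "w \<in> W" for w
  proof -
    \<comment> \<open>Negation is scalar multiplication by \<open>- 1\<close>, which lies in \<open>K\<close>.\<close>
    have "\<ominus> \<one> \<otimes> w \<in> W" using subW that Kc(3,5) by blast
    thus ?thesis using Wc[OF that] by (simp add: l_minus)
  qed
  have "V \<subseteq> W"
  proof
    fix v assume v: "v \<in> V"
    have vc: "v \<in> carrier R" using v Vc(1) by auto
    show "v \<in> W"
    proof (rule ccontr)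
      assume nv: "v \<notin> W"
      let ?f = "\<lambda>(w, k). w \<oplus> k \<otimes> v"
      let ?W' = "?f ` (W \<times> K)"
      have inj: "inj_on ?f (W \<times> K)"
      proof (rule inj_onI, clarsimp)
        fix w k w' k'
        assume h: "w \<in> W" "k \<in> K" "w' \<in> W" "k' \<in> K" and eq: "w \<oplus> k \<otimes> v = w' \<oplus> k' \<otimes> v"
        note c = Wc[OF h(1)] kc[OF h(2)] Wc[OF h(3)] kc[OF h(4)] vc
        have e: "(k \<oplus> \<ominus> k') \<otimes> v = w' \<oplus> \<ominus> w"
        proof -
          have xy: "k \<otimes> v \<in> carrier R" "k' \<otimes> v \<in> carrier R" using c by simp_all
          have "k \<otimes> v = \<ominus> w \<oplus> (w' \<oplus> k' \<otimes> v)"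
            unfolding eq[symmetric] using c xy by (simp add: r_neg1)
          also have "\<dots> = (w' \<oplus> \<ominus> w) \<oplus> k' \<otimes> v" using c xy by (simp add: a_ac)
          finally have "k \<otimes> v \<oplus> \<ominus> (k' \<otimes> v) = (w' \<oplus> \<ominus> w) \<oplus> (k' \<otimes> v \<oplus> \<ominus> (k' \<otimes> v))"
            using c xy a_assoc[of "w' \<oplus> \<ominus> w" "k' \<otimes> v" "\<ominus> (k' \<otimes> v)"] by simp
          thus ?thesis using c xy by (simp add: l_distr l_minus r_neg)
        qed
        have dK: "k \<oplus> \<ominus> k' \<in> K" using h Kc(5,7) by blast
        have "k \<oplus> \<ominus> k' = \<zero>"
        proof (rule ccontr)
          \<comment> \<open>Otherwise dividing \<open>(k - k') v = w' - w\<close> by \<open>k - k'\<close> would put \<open>v\<close> into \<open>W\<close>.\<close>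
          assume nz: "k \<oplus> \<ominus> k' \<noteq> \<zero>"
          hence "inv (k \<oplus> \<ominus> k') \<in> K" using K(2) dK by blast
          moreover have "w' \<oplus> \<ominus> w \<in> W" using subW h Wneg by blast
          ultimately have "inv (k \<oplus> \<ominus> k') \<otimes> ((k \<oplus> \<ominus> k') \<otimes> v) \<in> W" unfolding e using subW by blast
          moreover have "k \<oplus> \<ominus> k' \<in> Units R" using nz c by (simp add: Units_eq_nonzero)
          moreover from this have "inv (k \<oplus> \<ominus> k') \<otimes> ((k \<oplus> \<ominus> k') \<otimes> v) = v"
            using vc m_assoc[of "inv (k \<oplus> \<ominus> k')" "k \<oplus> \<ominus> k'" v] by (simp add: Units_closed)
          ultimately show False using nv by simp
        qed
        hence k: "k = k'" using c by (metis minus_equality minus_minus a_inv_closed a_comm)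
        have "w = w'" using eq c unfolding k by simp
        with k show "w = w' \<and> k = k'" by simp
      qed
      have "card ?W' = card K ^ Suc i"
        using card_image[OF inj] i by (simp add: card_cartesian_product)
      moreover have "?sub ?W'"
      proof (intro conjI ballI)
        have "k \<otimes> v \<in> V" if "k \<in> K" for k using that v V(2) Vc(6) by auto
        thus "?W' \<subseteq> V" using subW Vc(7) by (auto simp: subset_iff)
        show "\<zero> \<in> ?W'" using subW Kc(2) vc by (intro image_eqI[of _ _ "(\<zero>, \<zero>)"]) auto
      next
        fix x y assume "x \<in> ?W'" "y \<in> ?W'"
        then obtain w k w' k' where h: "w \<in> W" "k \<in> K" "w' \<in> W" "k' \<in> K"
          and xy: "x = w \<oplus> k \<otimes> v" "y = w' \<oplus> k' \<otimes> v" by auto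
        have "x \<oplus> y = ?f (w \<oplus> w', k \<oplus> k')"
          unfolding xy using Wc h kc vc by (simp add: l_distr a_ac)
        thus "x \<oplus> y \<in> ?W'" using subW h Kc(7) by blast
      next
        fix l x assume l: "l \<in> K" and "x \<in> ?W'"
        then obtain w k where h: "w \<in> W" "k \<in> K" and x: "x = w \<oplus> k \<otimes> v" by auto
        have "l \<otimes> x = ?f (l \<otimes> w, l \<otimes> k)"
          unfolding x using Wc h kc vc l by (simp add: r_distr m_assoc)
        thus "l \<otimes> x \<in> ?W'" using subW h l Kc(6) by blast
      qed
      ultimately have "?W' \<in> F" unfolding F_def by blast
      moreover have "W \<subseteq> ?W'"
      proof
        fix w assume "w \<in> W"
        thus "w \<in> ?W'" using Kc(2) Wc vc by (intro image_eqI[of _ _ "(w, \<zero>)"]) auto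
      qed
      ultimately have "?W' = W" by (rule max)
      moreover have "v \<in> ?W'" using subW Kc(3) vc by (intro image_eqI[of _ _ "(\<zero>, \<one>)"]) auto
      ultimately show False using nv by simp
    qed
  qed
  hence "W = V" using subW by auto
  with i show thesis using that by auto
qed

section \<open>The class equation\<close>

lemma conjugation_action:
  obtains \<phi> where "group_action (units_of R) (Units R) \<phi>"
    and "\<And>g x. \<lbrakk>g \<in> Units R; x \<in> Units R\<rbrakk> \<Longrightarrow> \<phi> g x = g \<otimes> x \<otimes> inv g"
proof -
  interpret U: group "units_of R" by (rule units_group)
  show thesis
    using U.action_by_conjugation
    by (rule that[unfolded units_of_carrier[symmetric]])
      (simp add: units_of_carrier units_of_mult units_of_inv)
qed

lemma conj_fixes_iff:
  assumes "g \<in> Units R" "x \<in> carrier R"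
  shows "g \<otimes> x \<otimes> inv g = x \<longleftrightarrow> g \<otimes> x = x \<otimes> g"
proof
  assume "g \<otimes> x \<otimes> inv g = x"
  hence "g \<otimes> x \<otimes> inv g \<otimes> g = x \<otimes> g" by simp
  thus "g \<otimes> x = x \<otimes> g" using assms by (simp add: m_assoc Units_closed)
next
  assume "g \<otimes> x = x \<otimes> g"
  thus "g \<otimes> x \<otimes> inv g = x" using assms by (simp add: m_assoc Units_closed)
qed

text \<open>
  The class equation as a divisibility statement. The noncentral elements form a union of conjugacy
  classes, and by orbit-stabilizer the size \<open>c\<close> of the class of \<open>x\<close> satisfies the equation in the
  second premise; a number dividing all these sizes divides the size of the union.
\<close>
lemma dvd_card_noncentral:
  assumes fin: "finite (carrier R)"
    and dvd: "\<And>x c. \<lbrakk>x \<in> carrier R; x \<notin> centralizer R (carrier R);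
        c * (card (centralizer R {x}) - 1) = card (carrier R) - 1\<rbrakk> \<Longrightarrow> a dvd c"
  shows "a dvd card (carrier R - centralizer R (carrier R))"
proof -
  let ?Z = "centralizer R (carrier R)"
  let ?N = "carrier R - ?Z"
  obtain \<phi> where act: "group_action (units_of R) (Units R) \<phi>"
    and \<phi>: "\<And>g x. \<lbrakk>g \<in> Units R; x \<in> Units R\<rbrakk> \<Longrightarrow> \<phi> g x = g \<otimes> x \<otimes> inv g"
    by (rule conjugation_action) blast
  interpret A: group_action "units_of R" "Units R" \<phi> by (rule act)
  let ?orb = "orbit (units_of R) \<phi>"
  have "\<zero> \<in> ?Z" by (rule subringE(2)[OF subring_centralizer]) simp
  hence NU: "?N \<subseteq> Units R" by (auto simp: Units_eq_nonzero)
  have central_fixed: "\<phi> g z = z" if "z \<in> ?Z" "z \<in> Units R" "g \<in> Units R" for z g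
    using that \<phi>[of g z] conj_fixes_iff[of g z] by (auto simp: centralizer_def Units_closed)
  have orb_sub: "?orb x \<subseteq> ?N" if x: "x \<in> ?N" for x
  proof
    fix y assume y: "y \<in> ?orb x"
    have xU: "x \<in> Units R" using x NU by auto
    have yU: "y \<in> Units R" using y xU A.element_image unfolding orbit_def by auto
    have xy: "x \<in> ?orb y" by (rule A.orbit_sym[OF xU yU y])
    have "y \<notin> ?Z"
    proof
      assume "y \<in> ?Z"
      hence "x = y" using xy central_fixed yU by (auto simp: orbit_def units_of_carrier)
      with \<open>y \<in> ?Z\<close> x show False by simp
    qed
    thus "y \<in> ?N" using yU by (auto simp: Units_closed)
  qed
  have cover: "\<Union> (?orb ` ?N) = ?N"
    using orb_sub A.orbit_refl NU by blast
  have "a dvd card (\<Union> (?orb ` ?N))"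
  proof (rule dvd_partition)
    show "finite (\<Union> (?orb ` ?N))" unfolding cover using fin by simp
    show "\<forall>c\<in>?orb ` ?N. a dvd card c"
    proof clarify
      fix x assume x: "x \<in> carrier R" "x \<notin> ?Z"
      hence xU: "x \<in> Units R" using NU by auto
      have "stabilizer (units_of R) \<phi> x = centralizer R {x} - {\<zero>}"
        using \<phi> conj_fixes_iff xU x
        by (auto simp: stabilizer_def centralizer_def units_of_carrier Units_eq_nonzero)
      moreover have "\<zero> \<in> centralizer R {x}"
        by (rule subringE(2)[OF subring_centralizer]) (use x in simp)
      moreover have "Coset.order (units_of R) = card (carrier R) - 1"
        using fin by (simp add: Coset.order_def units_of_carrier Units_eq_nonzero)
      ultimately have "card (?orb x) * (card (centralizer R {x}) - 1) = card (carrier R) - 1"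
        using A.orbit_stabilizer_theorem[OF xU] by simp
      with x show "a dvd card (?orb x)" by (rule dvd)
    qed
    show "\<forall>c1\<in>?orb ` ?N. \<forall>c2\<in>?orb ` ?N. c1 \<noteq> c2 \<longrightarrow> c1 \<inter> c2 = {}"
    proof -
      have "?orb ` ?N \<subseteq> orbits (units_of R) (Units R) \<phi>" using NU by (auto simp: orbits_def)
      thus ?thesis using A.disjoint_union by blast
    qed
  qed
  thus ?thesis by (simp only: cover)
qed

end

section \<open>Commutativity\<close>

theorem mainTheorem2:
  fixes R (structure)
  assumes "skew_field R"
    and "finite (carrier R)"
  shows "\<forall>x \<in> carrier R. \<forall>y \<in> carrier R. x \<otimes> y = y \<otimes> x"
proof -
  interpret skew_field R by fact
  let ?Z = "centralizer R (carrier R)" and ?C = "\<lambda>x. centralizer R {x}"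
  note fin = \<open>finite (carrier R)\<close>
  define q where "q = card ?Z"
  have Z: "subring ?Z R" by (rule subring_centralizer) simp
  have Zsub: "?Z \<subseteq> carrier R" by (auto simp: centralizer_def)
  have Zinv: "inv k \<in> ?Z" if "k \<in> ?Z" "k \<noteq> \<zero>" for k
    using that by (intro centralizer_inv_closed) auto
  have "{\<zero>, \<one>} \<subseteq> ?Z" using subringE(2,3)[OF Z] by simp
  hence "card {\<zero>, \<one>} \<le> q" unfolding q_def using fin Zsub finite_subset by (intro card_mono) auto
  hence q: "2 \<le> q" using one_not_zero by simp
  obtain n where n: "card (carrier R) = q ^ n"
    using card_eq_power_of_subring[OF fin Z Zinv carrier_is_subring Zsub] unfolding q_def by metis
  have "?Z = carrier R"
  proof (rule ccontr)
    assume "?Z \<noteq> carrier R"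
    hence "?Z \<subset> carrier R" using Zsub by simp
    hence "q ^ 1 < q ^ n" using psubset_card_mono[OF fin] n q_def by simp
    hence n2: "2 \<le> n" using q power_less_imp_less_exp[of q 1 n] by simp
    obtain a where a: "\<bar>a\<bar> > int q - 1"
      and a_dvd: "\<And>d m. \<lbrakk>0 < d; d dvd n; d < n; m * (int q ^ d - 1) = int q ^ n - 1\<rbrakk> \<Longrightarrow> a dvd m"
      using cyclotomic_divisor[OF n2 q] by blast
    have int_pred: "int (q ^ d - 1) = int q ^ d - 1" for d
      using q by (simp add: of_nat_diff)
    have "nat \<bar>a\<bar> dvd card (carrier R - ?Z)"
    proof (rule dvd_card_noncentral[OF fin])
      fix x c
      assume x: "x \<in> carrier R" "x \<notin> ?Z" and c: "c * (card (?C x) - 1) = card (carrier R) - 1"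
      have C: "subring (?C x) R" by (rule subring_centralizer) (use x in simp)
      have Csub: "?C x \<subseteq> carrier R" and ZC: "?Z \<subseteq> ?C x" using x by (auto simp: centralizer_def)
      have Cinv: "inv k \<in> ?C x" if "k \<in> ?C x" "k \<noteq> \<zero>" for k
        using that x by (intro centralizer_inv_closed) auto
      obtain d where d: "card (?C x) = q ^ d"
        using card_eq_power_of_subring[OF fin Z Zinv C ZC] unfolding q_def by metis
      obtain k where k: "card (carrier R) = card (?C x) ^ k"
        using card_eq_power_of_subring[OF fin C Cinv carrier_is_subring Csub] by metis
      \<comment> \<open>Counting \<open>R\<close> over the centralizer forces \<open>d\<close> to divide \<open>n\<close>.\<close>
      have "q ^ n = q ^ (d * k)" using n d k by (simp add: power_mult)
      hence "n = d * k" using q by simp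
      hence dn: "d dvd n" by simp
      hence d0: "0 < d" using n2 dvd_pos_nat[of n d] by simp
      have "?C x \<noteq> carrier R" using x unfolding centralizer_def by force
      hence "?C x \<subset> carrier R" using Csub by simp
      hence "q ^ d < q ^ n" using psubset_card_mono[OF fin] n d by metis
      hence "d < n" using q power_less_imp_less_exp[of q d n] by simp
      moreover have "int c * (int q ^ d - 1) = int q ^ n - 1"
        using c unfolding n d by (metis int_pred of_nat_mult)
      ultimately have "a dvd int c" using a_dvd d0 dn by blast
      thus "nat \<bar>a\<bar> dvd c" by (simp add: nat_abs_dvd_iff)
    qed
    also have "card (carrier R - ?Z) = q ^ n - q"
      using card_Diff_subset[OF finite_subset[OF Zsub fin] Zsub] n q_def by simp
    finally have "a dvd int (q ^ n - q)" by (simp add: nat_abs_dvd_iff)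
    moreover have "q \<le> q ^ n" using \<open>q ^ 1 < q ^ n\<close> by simp
    ultimately have 1: "a dvd int q ^ n - int q" by (simp add: of_nat_diff)
    \<comment> \<open>The divisor \<open>d = 1\<close> of \<open>n\<close> gives that \<open>a\<close> divides \<open>q ^ n - 1\<close> itself.\<close>
    have "(int q - 1) dvd (int q ^ n - 1)"
      using power_diff_1_eq[of "int q" n] by simp
    then obtain m where m: "int q ^ n - 1 = (int q - 1) * m" by (elim dvdE)
    have "a dvd m" using a_dvd[of 1 m] n2 m by (simp add: mult.commute)
    hence "a dvd int q ^ n - 1" unfolding m by simp
    hence "a dvd (int q ^ n - 1) - (int q ^ n - int q)" using 1 by (rule dvd_diff)
    hence "a dvd int q - 1" by simp
    hence "\<bar>a\<bar> \<le> \<bar>int q - 1\<bar>" using q dvd_imp_le_int[of "int q - 1" a] by simp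
    thus False using a q by simp
  qed
  thus ?thesis by (auto simp: centralizer_def)
qed

end
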